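(* Let $F$ be a field, let $n>1$ be an integer, and write $e_{i,j}$ for the $n\times n$ matrix over $F$ with $1$ in the $(i,j)$ entry and zeroes elsewhere. For $1\le i\le n-1$ put $$a_i=e_{i,i}+e_{i,i+1},\qquad a'_i=e_{i+1,i}+e_{i+1,i+1},$$ and put $b=e_{1,1}$. Then $S:=\{a_1,\dots,a_{n-1},a'_1,\dots,a'_{n-1},b\}$ is an irredundant generating set for $\mathrm{M}_n(F)$ consisting of $2n-1$ elements.
   Context: A subset $S\subseteq \mathrm{M}_n(F)$ is called an irredundant generating set for $\mathrm{M}_n(F)$ if $S$ generates $\mathrm{M}_n(F)$ as a unital $F$-algebra and no proper subset of $S$ does. *)

theory Defs
  imports "Jordan_Normal_Form.Matrix"
begin

definition unital_subalgebra :: "nat \<Rightarrow> 'a::field mat set \<Rightarrow> bool" where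
  "unital_subalgebra n A \<longleftrightarrow>
     A \<subseteq> carrier_mat n n \<and> 0\<^sub>m n n \<in> A \<and> 1\<^sub>m n \<in> A \<and>
     (\<forall>X\<in>A. \<forall>Y\<in>A. X + Y \<in> A) \<and>
     (\<forall>X\<in>A. \<forall>Y\<in>A. X * Y \<in> A) \<and>
     (\<forall>c. \<forall>X\<in>A. c \<cdot>\<^sub>m X \<in> A)"

definition generated_subalgebra :: "nat \<Rightarrow> 'a::field mat set \<Rightarrow> 'a mat set" where
  "generated_subalgebra n S = \<Inter> {A. unital_subalgebra n A \<and> S \<subseteq> A}"

definition generates_mat_algebra :: "nat \<Rightarrow> 'a::field mat set \<Rightarrow> bool" where
  "generates_mat_algebra n S \<longleftrightarrow>
     S \<subseteq> carrier_mat n n \<and> generated_subalgebra n S = carrier_mat n n"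

definition irredundant_generating_set :: "nat \<Rightarrow> 'a::field mat set \<Rightarrow> bool" where
  "irredundant_generating_set n S \<longleftrightarrow>
     generates_mat_algebra n S \<and> (\<forall>T. T \<subset> S \<longrightarrow> \<not> generates_mat_algebra n T)"

(* Rows and columns of matrix_unit are numbered from 1 to n, whereas the
   entries of the type mat are numbered from 0 to n - 1. *)
definition matrix_unit :: "nat \<Rightarrow> nat \<Rightarrow> nat \<Rightarrow> 'a::field mat" where
  "matrix_unit n i j = mat n n (\<lambda>(r, c). if r + 1 = i \<and> c + 1 = j then 1 else 0)"

end

(*
  Write f_0 for the first coordinate functional and f_i for the sum of the i-th and (i+1)-st ones,
  so that b = e_1 f_0, a_i = e_i f_i and a'_i = e_(i+1) f_i.

  Generation: once e_(i,i) is available, a_i yields e_(i,i+1), the product a'_i e_(i,i) is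
  e_(i+1,i), and then a'_i yields e_(i+1,i+1); so all matrix units are reached from b = e_(1,1).

  Irredundance: for each generator, a proper subspace is invariant under all the others but not
  under it. For b take the line spanned by (1,-1,1,...), which every f_i with i > 0 kills; for a_i
  take the span of e_(i+1),...,e_n, and for a'_i the span of e_1,...,e_i. These stabilisers
  also separate the generators from each other, which gives the cardinality.
*)
theory Submission
  imports Defs
begin

section \<open>Products and actions of matrix units\<close>

lemma matrix_unit_carrier [simp]: "matrix_unit n i j \<in> carrier_mat n n"
  by (simp add: matrix_unit_def)

lemma index_matrix_unit [simp]:
  "r < n \<Longrightarrow> c < n \<Longrightarrow> matrix_unit n i j $$ (r, c) = (if r + 1 = i \<and> c + 1 = j then 1 else 0)"
  by (simp add: matrix_unit_def)

lemma dim_matrix_unit [simp]: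
  "dim_row (matrix_unit n i j) = n" "dim_col (matrix_unit n i j) = n"
  by (simp_all add: matrix_unit_def)

lemma matrix_unit_mult_matrix_unit:
  assumes "1 \<le> j" "j \<le> n"
  shows "matrix_unit n i j * matrix_unit n j k = (matrix_unit n i k :: 'a::field mat)"
proof (rule eq_matI)
  fix r c assume "r < dim_row (matrix_unit n i k :: 'a mat)" "c < dim_col (matrix_unit n i k :: 'a mat)"
  then have rc: "r < n" "c < n" by simp_all
  have "(matrix_unit n i j * matrix_unit n j k) $$ (r, c) =
      (\<Sum>s\<in>{0..<n}. matrix_unit n i j $$ (r, s) * (matrix_unit n j k $$ (s, c) :: 'a))"
    using rc by (simp add: scalar_prod_def)
  \<comment> \<open>The only inner index that can contribute is \<open>j - 1\<close>, the 0-based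
    position of the 1-based index \<open>j\<close>; the bounds on \<open>j\<close> keep it in range
    and make the truncated subtraction exact.\<close>
  also have "\<dots> = (\<Sum>s\<in>{0..<n}. if s = j - 1 then matrix_unit n i k $$ (r, c) else 0)"
    using rc assms by (intro sum.cong) auto
  finally show "(matrix_unit n i j * matrix_unit n j k) $$ (r, c) = (matrix_unit n i k $$ (r, c) :: 'a)"
    using assms by simp
qed simp_all

lemma index_matrix_unit_mult_vec:
  assumes "v \<in> carrier_vec n" "1 \<le> j" "j \<le> n" "r < n"
  shows "(matrix_unit n i j *\<^sub>v v) $ r = (if r + 1 = i then v $ (j - 1) else (0::'a::field))"
proof -
  have "(matrix_unit n i j *\<^sub>v v) $ r = (\<Sum>s\<in>{0..<n}. matrix_unit n i j $$ (r, s) * v $ s)"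
    using assms by (simp add: scalar_prod_def)
  also have "\<dots> = (\<Sum>s\<in>{0..<n}. if s = j - 1 then (if r + 1 = i then v $ (j - 1) else 0) else 0)"
    using assms by (intro sum.cong) auto
  finally show ?thesis using assms by (auto simp del: index_mult_mat_vec)
qed

section \<open>Unital subalgebras, stabilisers and a criterion for irredundance\<close>

lemma unital_subalgebra_minus:
  assumes "unital_subalgebra n A" "X + Y \<in> A" "X \<in> A" "Y \<in> carrier_mat n n"
  shows "Y \<in> A"
proof -
  have X: "X \<in> carrier_mat n n" and "(- 1) \<cdot>\<^sub>m X \<in> A"
    using assms unfolding unital_subalgebra_def by blast+
  then have "(X + Y) + (- 1) \<cdot>\<^sub>m X \<in> A"
    using assms unfolding unital_subalgebra_def by blast
  also have "(X + Y) + (- 1) \<cdot>\<^sub>m X = Y"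
    using X assms(4) by (intro eq_matI) auto
  finally show ?thesis .
qed

text \<open>A matrix is assembled entry by entry: induction over a finite set \<open>E\<close> of
  positions adds one scaled matrix unit at a time to the matrix cut down to
  \<open>E\<close>.\<close>

lemma unital_subalgebra_eq_carrier:
  fixes A :: "'a::field mat set"
  assumes A: "unital_subalgebra n A"
    and units: "\<And>i j. 1 \<le> i \<Longrightarrow> i \<le> n \<Longrightarrow> 1 \<le> j \<Longrightarrow> j \<le> n \<Longrightarrow> matrix_unit n i j \<in> A"
  shows "A = carrier_mat n n"
proof
  show "A \<subseteq> carrier_mat n n" using A by (simp add: unital_subalgebra_def)
  show "carrier_mat n n \<subseteq> A"
  proof
    fix X :: "'a mat" assume X: "X \<in> carrier_mat n n"
    have restrict: "mat n n (\<lambda>p. if p \<in> E then X $$ p else 0) \<in> A"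
      if "finite E" "E \<subseteq> {..<n} \<times> {..<n}" for E
      using that
    proof (induction E rule: finite_induct)
      case empty
      have "mat n n (\<lambda>p. if p \<in> {} then X $$ p else 0) = 0\<^sub>m n n"
        by (intro eq_matI) auto
      then show ?case using A by (simp add: unital_subalgebra_def)
    next
      case (insert p E)
      obtain r c where p: "p = (r, c)" by force
      with insert.prems have rc: "r < n" "c < n" by auto
      have "X $$ p \<cdot>\<^sub>m matrix_unit n (r + 1) (c + 1) \<in> A"
        using A units[of "r + 1" "c + 1"] rc unfolding unital_subalgebra_def by auto
      moreover have "mat n n (\<lambda>p. if p \<in> E then X $$ p else 0) \<in> A"
        using insert by auto
      ultimately have "X $$ p \<cdot>\<^sub>m matrix_unit n (r + 1) (c + 1)
          + mat n n (\<lambda>p. if p \<in> E then X $$ p else 0) \<in> A"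
        using A unfolding unital_subalgebra_def by blast
      \<comment> \<open>As \<open>p\<close> lies outside \<open>E\<close>, the cut-down matrix has 0
        there, so the scaled unit supplies exactly this entry. The shifts by 1 pass from 0-based
        positions to the 1-based indices of \<open>matrix_unit\<close>.\<close>
      also have "X $$ p \<cdot>\<^sub>m matrix_unit n (r + 1) (c + 1)
          + mat n n (\<lambda>p. if p \<in> E then X $$ p else 0)
          = mat n n (\<lambda>q. if q \<in> insert p E then X $$ q else 0)"
        using insert.hyps p by (intro eq_matI) auto
      finally show ?case .
    qed
    have "X = mat n n (\<lambda>p. if p \<in> {..<n} \<times> {..<n} then X $$ p else 0)"
      using X by (intro eq_matI) auto
    with restrict[of "{..<n} \<times> {..<n}"] show "X \<in> A" by simp
  qed
qed

text \<open>This is the stabiliser of the span of the coordinate vectors selected by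
  \<open>P\<close>. For products, take an inner index \<open>s\<close>: if \<open>P s\<close>, the
  entry (r, s) of the left factor vanishes, otherwise the entry (s, c) of the right one
  does.\<close>

lemma unital_subalgebra_coordinate_stabiliser:
  "unital_subalgebra n
     {X \<in> carrier_mat n n. \<forall>r<n. \<forall>c<n. \<not> P r \<longrightarrow> P c \<longrightarrow> X $$ (r, c) = (0::'a::field)}"
proof -
  have "(X * Y) $$ (r, c) = 0"
    if "X \<in> carrier_mat n n" "Y \<in> carrier_mat n n" "r < n" "c < n" "\<not> P r" "P c"
      "\<forall>r<n. \<forall>c<n. \<not> P r \<longrightarrow> P c \<longrightarrow> X $$ (r, c) = 0"
      "\<forall>r<n. \<forall>c<n. \<not> P r \<longrightarrow> P c \<longrightarrow> Y $$ (r, c) = 0" for X Y :: "'a mat" and r c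
  proof -
    have "X $$ (r, s) * Y $$ (s, c) = 0" if "s < n" for s
      using that \<open>r < n\<close> \<open>c < n\<close> \<open>\<not> P r\<close> \<open>P c\<close>
        \<open>\<forall>r<n. \<forall>c<n. \<not> P r \<longrightarrow> P c \<longrightarrow> X $$ (r, c) = 0\<close>
        \<open>\<forall>r<n. \<forall>c<n. \<not> P r \<longrightarrow> P c \<longrightarrow> Y $$ (r, c) = 0\<close>
      by (cases "P s") auto
    then show ?thesis
      using that(1-4) by (simp add: scalar_prod_def sum.neutral del: mult_eq_0_iff)
  qed
  then show ?thesis
    unfolding unital_subalgebra_def by auto
qed

text \<open>The scalars by which matrices act on \<open>v\<close> add and multiply along with the
  matrices, so the property survives all the algebra operations.\<close>

lemma unital_subalgebra_line_stabiliser: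
  fixes v :: "'a::field vec"
  assumes v: "v \<in> carrier_vec n"
  shows "unital_subalgebra n {X \<in> carrier_mat n n. \<exists>k. X *\<^sub>v v = k \<cdot>\<^sub>v v}"
proof -
  have zero: "\<exists>k. 0\<^sub>m n n *\<^sub>v v = k \<cdot>\<^sub>v v"
    using v by (intro exI[of _ 0] eq_vecI) auto
  have one: "\<exists>k. 1\<^sub>m n *\<^sub>v v = k \<cdot>\<^sub>v v"
    using v by (intro exI[of _ 1]) auto
  have add: "\<exists>m. (X + Y) *\<^sub>v v = m \<cdot>\<^sub>v v"
    if "X \<in> carrier_mat n n" "Y \<in> carrier_mat n n" "X *\<^sub>v v = k \<cdot>\<^sub>v v" "Y *\<^sub>v v = l \<cdot>\<^sub>v v"
    for X Y k l
    using that v by (intro exI[of _ "k + l"]) (simp add: add_mult_distrib_mat_vec add_smult_distrib_vec)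
  have mult: "\<exists>m. (X * Y) *\<^sub>v v = m \<cdot>\<^sub>v v"
    if "X \<in> carrier_mat n n" "Y \<in> carrier_mat n n" "X *\<^sub>v v = k \<cdot>\<^sub>v v" "Y *\<^sub>v v = l \<cdot>\<^sub>v v"
    for X Y k l
    using that v
    by (intro exI[of _ "l * k"]) (simp add: assoc_mult_mat_vec mult_mat_vec smult_smult_assoc)
  have smult: "\<exists>m. (c \<cdot>\<^sub>m X) *\<^sub>v v = m \<cdot>\<^sub>v v"
    if "X \<in> carrier_mat n n" "X *\<^sub>v v = k \<cdot>\<^sub>v v" for X c k
  proof (intro exI[of _ "c * k"])
    have "(c \<cdot>\<^sub>m X) *\<^sub>v v = c \<cdot>\<^sub>v (X *\<^sub>v v)"
      using that(1) v by (intro eq_vecI) auto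
    then show "(c \<cdot>\<^sub>m X) *\<^sub>v v = (c * k) \<cdot>\<^sub>v v"
      using that(2) by (simp add: smult_smult_assoc)
  qed
  show ?thesis
    unfolding unital_subalgebra_def using zero one add mult smult by auto
qed

text \<open>A subset of the family that misses \<open>x k\<close> lies inside the separating
  subalgebra \<open>B\<close>, and so does everything it generates, but \<open>x k\<close> does not.
  The same \<open>B\<close> shows that \<open>x j = x k\<close> is impossible for
  \<open>j \<noteq> k\<close>. Indexing by \<open>I\<close> lets the count be read off the
  labels.\<close>

lemma irredundant_family:
  assumes gen: "generates_mat_algebra n (x ` I)"
    and sep: "\<And>k. k \<in> I \<Longrightarrow> \<exists>B. unital_subalgebra n B \<and> x k \<notin> B \<and> (\<forall>j\<in>I. j \<noteq> k \<longrightarrow> x j \<in> B)"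
  shows "irredundant_generating_set n (x ` I)" and "inj_on x I"
proof -
  show "inj_on x I"
    unfolding inj_on_def using sep by metis
  have "\<not> generates_mat_algebra n T" if T: "T \<subset> x ` I" for T
  proof
    assume "generates_mat_algebra n T"
    moreover obtain k where k: "k \<in> I" "x k \<notin> T" using T by auto
    then obtain B where B: "unital_subalgebra n B" "x k \<notin> B" "\<forall>j\<in>I. j \<noteq> k \<longrightarrow> x j \<in> B"
      using sep by blast
    have "T \<subseteq> B"
    proof
      fix y assume "y \<in> T"
      then obtain j where "j \<in> I" "y = x j" using T by blast
      with \<open>y \<in> T\<close> show "y \<in> B" using B(3) k(2) by metis
    qed
    ultimately have "carrier_mat n n \<subseteq> B"
      using B(1) unfolding generates_mat_algebra_def generated_subalgebra_def by blast
    moreover have "x k \<in> carrier_mat n n"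
      using gen k(1) unfolding generates_mat_algebra_def by blast
    ultimately show False using B(2) by blast
  qed
  with gen show "irredundant_generating_set n (x ` I)"
    unfolding irredundant_generating_set_def by blast
qed

section \<open>Generation of the full matrix algebra\<close>

lemma generates_mat_algebra_idempotents:
  fixes a a' :: "nat \<Rightarrow> 'a::field mat"
  assumes "n > 1"
    and a: "\<And>i. 1 \<le> i \<Longrightarrow> i \<le> n - 1 \<Longrightarrow> a i = matrix_unit n i i + matrix_unit n i (i + 1)"
    and a': "\<And>i. 1 \<le> i \<Longrightarrow> i \<le> n - 1 \<Longrightarrow>
           a' i = matrix_unit n (i + 1) i + matrix_unit n (i + 1) (i + 1)"
  shows "generates_mat_algebra n (a ` {1..n - 1} \<union> a' ` {1..n - 1} \<union> {matrix_unit n 1 1})"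
    (is "generates_mat_algebra n ?S")
proof -
  have carrier: "?S \<subseteq> carrier_mat n n"
    using a a' by auto
  have full: "A = carrier_mat n n" if A: "unital_subalgebra n A" and S: "?S \<subseteq> A" for A
  proof -
    have mult: "X * Y \<in> A" if "X \<in> A" "Y \<in> A" for X Y
      using A that unfolding unital_subalgebra_def by blast
    have a_in: "matrix_unit n i i + matrix_unit n i (i + 1) \<in> A"
      and a'_in: "matrix_unit n (i + 1) i + matrix_unit n (i + 1) (i + 1) \<in> A"
      if "1 \<le> i" "i < n" for i
    proof -
      have "i \<in> {1..n - 1}" using that by auto
      then have "a i \<in> A" "a' i \<in> A" using S by blast+
      then show "matrix_unit n i i + matrix_unit n i (i + 1) \<in> A"
        and "matrix_unit n (i + 1) i + matrix_unit n (i + 1) (i + 1) \<in> A"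
        using a[of i] a'[of i] that by auto
    qed
    have lower_step: "matrix_unit n (i + 1) i \<in> A"
      if "1 \<le> i" "i < n" "matrix_unit n i i \<in> A" for i
    proof -
      have "(matrix_unit n (i + 1) i + matrix_unit n (i + 1) (i + 1)) * matrix_unit n i i
          = (matrix_unit n (i + 1) i * matrix_unit n i i
              + matrix_unit n (i + 1) (i + 1) * matrix_unit n i i :: 'a mat)"
        by (rule add_mult_distrib_mat[of _ n n _ _ n]) simp_all
      also have "matrix_unit n (i + 1) i * matrix_unit n i i = (matrix_unit n (i + 1) i :: 'a mat)"
        using that by (intro matrix_unit_mult_matrix_unit) auto
      \<comment> \<open>The inner indices \<open>i + 1\<close> and \<open>i\<close> differ, so every
        summand of every entry has a zero factor.\<close>
      also have "matrix_unit n (i + 1) (i + 1) * matrix_unit n i i = (0\<^sub>m n n :: 'a mat)"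
        by (intro eq_matI) (auto simp: scalar_prod_def intro!: sum.neutral)
      finally show ?thesis
        using mult[OF a'_in[OF that(1,2)] that(3)] by simp
    qed
    have diag: "matrix_unit n i i \<in> A" if "1 \<le> i" "i \<le> n" for i
      using that
    proof (induction i rule: dec_induct)
      case base
      show ?case using S by simp
    next
      case (step i)
      then have "matrix_unit n i i \<in> A" by simp
      then show ?case
        using unital_subalgebra_minus[OF A a'_in lower_step] step by simp
    qed
    have upper_step: "matrix_unit n i (i + 1) \<in> A" if "1 \<le> i" "i < n" for i
      using unital_subalgebra_minus[OF A a_in diag] that by simp
    \<comment> \<open>From the diagonal, right multiplication by superdiagonal units moves along row
      \<open>i\<close>; below the diagonal, left multiplication by subdiagonal units moves down
      column \<open>j\<close>.\<close>
    have upper: "matrix_unit n i j \<in> A" if "1 \<le> i" "i \<le> j" "j \<le> n" for i j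
      using that(2,1,3)
    proof (induction j rule: dec_induct)
      case base
      then show ?case using diag by simp
    next
      case (step j)
      then have "matrix_unit n i j * matrix_unit n j (j + 1) \<in> A"
        using upper_step by (intro mult) auto
      then show ?case using step by (simp add: matrix_unit_mult_matrix_unit)
    qed
    have lower: "matrix_unit n i j \<in> A" if "1 \<le> j" "j \<le> i" "i \<le> n" for i j
      using that(2,1,3)
    proof (induction i rule: dec_induct)
      case base
      then show ?case using diag by simp
    next
      case (step i)
      then have "matrix_unit n (i + 1) i * matrix_unit n i j \<in> A"
        using lower_step diag by (intro mult) auto
      then show ?case using step by (simp add: matrix_unit_mult_matrix_unit)
    qed
    show ?thesis
      using A
    proof (rule unital_subalgebra_eq_carrier)
      fix i j assume "1 \<le> i" "i \<le> n" "1 \<le> j" "j \<le> n"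
      then show "matrix_unit n i j \<in> A"
        using upper[of i j] lower[of j i] by (cases "i \<le> j") auto
    qed
  qed
  \<comment> \<open>By \<open>full\<close> no other subalgebra can contain the generators; this one
    makes the intersected family nonempty, so that the intersection is not the whole type.\<close>
  have "unital_subalgebra n (carrier_mat n n :: 'a mat set)"
    by (auto simp: unital_subalgebra_def)
  with carrier full show ?thesis
    unfolding generates_mat_algebra_def generated_subalgebra_def by blast
qed

section \<open>Separation of the generators and their number\<close>

theorem proposition3p1:
  fixes n :: nat
    and a a' :: "nat \<Rightarrow> 'a::field mat"
    and b :: "'a mat"
    and S :: "'a mat set"
  assumes "n > 1"
    and "\<And>i. 1 \<le> i \<Longrightarrow> i \<le> n - 1 \<Longrightarrow> a i = matrix_unit n i i + matrix_unit n i (i + 1)"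
    and "\<And>i. 1 \<le> i \<Longrightarrow> i \<le> n - 1 \<Longrightarrow>
           a' i = matrix_unit n (i + 1) i + matrix_unit n (i + 1) (i + 1)"
    and "b = matrix_unit n 1 1"
    and "S = a ` {1..n - 1} \<union> a' ` {1..n - 1} \<union> {b}"
  shows "irredundant_generating_set n S \<and> card S = 2 * n - 1"
proof -
  \<comment> \<open>The disjoint sum gives each generator its own label, so \<open>I\<close> has (n
    - 1) + (n - 1) + 1 elements before the matrices are known to be distinct.\<close>
  define I where "I = {1..n - 1} <+> {1..n - 1} <+> {()}"
  define x where "x = case_sum a (case_sum a' (\<lambda>_::unit. b))"
  have S: "S = x ` I"
    by (auto simp: assms(5) I_def x_def Plus_def image_Un image_image)
  have gen: "generates_mat_algebra n (x ` I)"
    using generates_mat_algebra_idempotents[OF assms(1-3)] assms(4,5) S by simp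

  define L :: "(nat \<Rightarrow> bool) \<Rightarrow> 'a mat set" where "L = (\<lambda>P.
    {X \<in> carrier_mat n n. \<forall>r<n. \<forall>c<n. \<not> P r \<longrightarrow> P c \<longrightarrow> X $$ (r, c) = 0})"
  have L: "unital_subalgebra n (L P)" for P
    unfolding L_def by (rule unital_subalgebra_coordinate_stabiliser)
  define v :: "'a vec" where "v = vec n (\<lambda>r. (- 1) ^ r)"
  have v: "v \<in> carrier_vec n" by (simp add: v_def)
  define V where "V = {X \<in> carrier_mat n n. \<exists>k. X *\<^sub>v v = k \<cdot>\<^sub>v v}"
  have V: "unital_subalgebra n V"
    unfolding V_def using v by (rule unital_subalgebra_line_stabiliser)

  \<comment> \<open>The row \<open>i\<close> is independent of \<open>j\<close>, so one computation
    covers both \<open>a j\<close> (row \<open>j\<close>) and \<open>a' j\<close> (row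
    \<open>j + 1\<close>).\<close>
  have kill: "(matrix_unit n i j + matrix_unit n i (j + 1)) *\<^sub>v v = 0 \<cdot>\<^sub>v v"
    if "1 \<le> j" "j \<le> n - 1" for i j
  proof (rule eq_vecI)
    fix r assume "r < dim_vec (0 \<cdot>\<^sub>v v)"
    then have "r < n" by (simp add: v_def)
    \<comment> \<open>The two coordinates read off become \<open>(- 1) ^ m\<close> and
      \<open>(- 1) ^ Suc m\<close>, which cancel.\<close>
    obtain m where "j = Suc m" using \<open>1 \<le> j\<close> by (cases j) auto
    then show "((matrix_unit n i j + matrix_unit n i (j + 1)) *\<^sub>v v) $ r = (0 \<cdot>\<^sub>v v) $ r"
      using that \<open>r < n\<close> v
      by (simp add: add_mult_distrib_mat_vec[of _ n n] index_matrix_unit_mult_vec[OF v]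
          del: index_mult_mat_vec) (simp add: v_def)
  qed (simp add: v_def)
  have "a i \<in> V" "a' i \<in> V" if "i \<in> {1..n - 1}" for i
    using that kill[of i] by (auto simp: V_def assms(2,3) intro!: exI[of _ 0])
  moreover have "b \<notin> V"
  proof
    assume "b \<in> V"
    then obtain k where "b *\<^sub>v v = k \<cdot>\<^sub>v v" by (auto simp: V_def)
    \<comment> \<open>The first two coordinates of \<open>v\<close> are 1 and -1, those of its image
      under \<open>b\<close> are 1 and 0: the former force \<open>k = 1\<close>, the latter
      \<open>k = 0\<close>. The second coordinate exists because \<open>n > 1\<close>.\<close>
    then have "(b *\<^sub>v v) $ 0 = k * v $ 0" "(b *\<^sub>v v) $ 1 = k * v $ 1"
      using assms(1) v by auto
    then show False
      using assms(1) unfolding assms(4)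
      by (simp add: index_matrix_unit_mult_vec[OF v] del: index_mult_mat_vec)
        (simp add: v_def)
  qed
  ultimately have sep_b: "x k \<notin> V \<and> (\<forall>j\<in>I. j \<noteq> k \<longrightarrow> x j \<in> V)" if "k = Inr (Inr ())" for k
    using that by (auto simp: x_def I_def)

  \<comment> \<open>In 0-based numbering \<open>i \<le> r\<close> selects e_(i+1),...,e_n. The
    nonzero entries of \<open>a j\<close> are in row \<open>j - 1\<close>, columns
    \<open>j - 1\<close> and \<open>j\<close>, so a violation needs
    \<open>j - 1 < i \<le> j\<close>, that is \<open>j = i\<close>.\<close>
  have sep_a: "x (Inl i) \<notin> L (\<lambda>r. i \<le> r) \<and> (\<forall>j\<in>I. j \<noteq> Inl i \<longrightarrow> x j \<in> L (\<lambda>r. i \<le> r))"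
    if i: "i \<in> {1..n - 1}" for i
  proof -
    have "a i $$ (i - 1, i) \<noteq> 0" "i - 1 < n" "i < n" "\<not> i \<le> i - 1"
      using i by (auto simp: assms(2))
    then have "a i \<notin> L (\<lambda>r. i \<le> r)" unfolding L_def by blast
    moreover have "a j \<in> L (\<lambda>r. i \<le> r)" if "j \<in> {1..n - 1}" "j \<noteq> i" for j
      using that by (auto simp: L_def assms(2))
    moreover have "a' j \<in> L (\<lambda>r. i \<le> r)" if "j \<in> {1..n - 1}" for j
      using that by (auto simp: L_def assms(3))
    moreover have "b \<in> L (\<lambda>r. i \<le> r)"
      using i by (auto simp: L_def assms(4))
    ultimately show ?thesis
      unfolding I_def by (simp add: x_def Plus_def ball_Un del: atLeastAtMost_iff)
  qed

  \<comment> \<open>Here \<open>r < i\<close> selects e_1,...,e_i. The nonzero entries of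
    \<open>a' j\<close> are in row \<open>j\<close>, columns \<open>j - 1\<close> and
    \<open>j\<close>, so again only \<open>j = i\<close> crosses the boundary, now in the opposite
    direction.\<close>
  have sep_a': "x (Inr (Inl i)) \<notin> L (\<lambda>r. r < i) \<and>
      (\<forall>j\<in>I. j \<noteq> Inr (Inl i) \<longrightarrow> x j \<in> L (\<lambda>r. r < i))"
    if i: "i \<in> {1..n - 1}" for i
  proof -
    have "a' i $$ (i, i - 1) \<noteq> 0" "i - 1 < n" "i < n" "i - 1 < i"
      using i by (auto simp: assms(3))
    then have "a' i \<notin> L (\<lambda>r. r < i)" unfolding L_def by blast
    moreover have "a' j \<in> L (\<lambda>r. r < i)" if "j \<in> {1..n - 1}" "j \<noteq> i" for j
      using that by (auto simp: L_def assms(3))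
    moreover have "a j \<in> L (\<lambda>r. r < i)" if "j \<in> {1..n - 1}" for j
      using that by (auto simp: L_def assms(2))
    moreover have "b \<in> L (\<lambda>r. r < i)"
      using i by (auto simp: L_def assms(4))
    ultimately show ?thesis
      unfolding I_def by (simp add: x_def Plus_def ball_Un del: atLeastAtMost_iff)
  qed

  have sep: "\<exists>B. unital_subalgebra n B \<and> x k \<notin> B \<and> (\<forall>j\<in>I. j \<noteq> k \<longrightarrow> x j \<in> B)"
    if "k \<in> I" for k
  proof -
    consider i where "k = Inl i" "i \<in> {1..n - 1}" | i where "k = Inr (Inl i)" "i \<in> {1..n - 1}"
      | "k = Inr (Inr ())"
      using \<open>k \<in> I\<close> by (auto simp: I_def)
    then show ?thesis
      using sep_a sep_a' sep_b L V by cases blast+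
  qed

  have "card S = card I"
    unfolding S by (rule card_image[OF irredundant_family(2)[OF gen sep]])
  also have "card I = 2 * n - 1"
    using assms(1) by (simp add: I_def card_Plus)
  finally show ?thesis
    unfolding S using irredundant_family(1)[OF gen sep] by simp
qed

end
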